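(* Let $\mathcal{C}$ be a ($\mathsf{Pos}$-enriched) category satisfying the following three conditions: (R1) $\mathcal{C}$ has all finite (weighted) limits; (R2) $\mathcal{C}$ has $(\mathsf{so},\mathsf{ff})$-factorizations, i.e. every morphism $f$ of $\mathcal{C}$ can be written $f=me$ with $e$ an $\mathsf{so}$-morphism and $m$ an $\mathsf{ff}$-morphism; (R3) $\mathsf{so}$-morphisms are stable under pullback in $\mathcal{C}$. Then $\mathcal{C}$ also satisfies: (R4) every $\mathsf{so}$-morphism in $\mathcal{C}$ is effective, i.e. is the coinserter of some pair of parallel morphisms.
   Context: All categories are enriched over the cartesian closed category $\mathsf{Pos}$ of posets and monotone maps: each hom-set is partially ordered and composition is monotone in each variable. Limits and colimits are weighted ($\mathsf{Pos}$-enriched); in particular the projections of products and pullbacks are required to be jointly order-monomorphic, where a family $(p_i)$ of morphisms with common domain is jointly order-monomorphic if $p_iu\le p_iv$ for all $i$ implies $u\le v$. "Finite limits" means all finite weighted limits (finite products, equalizers, and finite powers $X^P$ with $P$ a finite poset). A morphism $m\colon X\to Y$ is an $\mathsf{ff}$-morphism (order-monomorphism) if for all $f,g\colon Z\to X$, $mf\le mg$ implies $f\le g$. A morphism $e\colon A\to B$ is an $\mathsf{so}$-morphism if $e\perp m$ for every $\mathsf{ff}$-morphism $m\colon X\to Y$, where $e\perp m$ means that the square formed by $-\circ e\colon\mathcal{C}(B,X)\to\mathcal{C}(A,X)$, $m\circ-\colon\mathcal{C}(B,X)\to\mathcal{C}(B,Y)$, $m\circ-\colon\mathcal{C}(A,X)\to\mathcal{C}(A,Y)$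 and $-\circ e\colon\mathcal{C}(B,Y)\to\mathcal{C}(A,Y)$ is a pullback in $\mathsf{Pos}$. The coinserter of an ordered pair $f_0,f_1\colon C\to A$ is a morphism $e\colon A\to B$ with $ef_0\le ef_1$ such that every $g\colon A\to Z$ with $gf_0\le gf_1$ factors as $g=ue$ for some $u\colon B\to Z$, and such that $ue\le ve$ implies $u\le v$ for all $u,v\colon B\to Z$. *)

theory Defs
  imports Main
begin

definition poset_on :: "'a set \<Rightarrow> ('a \<Rightarrow> 'a \<Rightarrow> bool) \<Rightarrow> bool" where
  "poset_on A le \<longleftrightarrow> reflp_on A le \<and> transp_on A le \<and> antisymp_on A le"

text \<open>Categories enriched over posets. As usual for carrier-based structures, composition and
  order are total functions on the type of arrows and are only meaningful on composable,
  respectively parallel, arrows. \<open>Comp C g f\<close> is \<open>g\<close> after \<open>f\<close>.\<close>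

record ('o, 'm) pos_cat =
  Obj :: "'o set"
  Arr :: "'m set"
  Dom :: "'m \<Rightarrow> 'o"
  Cod :: "'m \<Rightarrow> 'o"
  Id :: "'o \<Rightarrow> 'm"
  Comp :: "'m \<Rightarrow> 'm \<Rightarrow> 'm" (infixl "\<cdot>\<index>" 70)
  Leq :: "'m \<Rightarrow> 'm \<Rightarrow> bool" (infix "\<sqsubseteq>\<index>" 50)

definition hom :: "('o, 'm) pos_cat \<Rightarrow> 'o \<Rightarrow> 'o \<Rightarrow> 'm set" where
  "hom C X Y = {f \<in> Arr C. Dom C f = X \<and> Cod C f = Y}"

locale pos_category =
  fixes C :: "('o, 'm) pos_cat" (structure)
  assumes dom_obj: "f \<in> Arr C \<Longrightarrow> Dom C f \<in> Obj C"
    and cod_obj: "f \<in> Arr C \<Longrightarrow> Cod C f \<in> Obj C"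
    and id_hom: "X \<in> Obj C \<Longrightarrow> Id C X \<in> hom C X X"
    and comp_hom: "\<lbrakk>f \<in> hom C X Y; g \<in> hom C Y Z\<rbrakk> \<Longrightarrow> g \<cdot> f \<in> hom C X Z"
    and id_left: "f \<in> hom C X Y \<Longrightarrow> Id C Y \<cdot> f = f"
    and id_right: "f \<in> hom C X Y \<Longrightarrow> f \<cdot> Id C X = f"
    and assoc: "\<lbrakk>f \<in> hom C W X; g \<in> hom C X Y; h \<in> hom C Y Z\<rbrakk>
      \<Longrightarrow> (h \<cdot> g) \<cdot> f = h \<cdot> (g \<cdot> f)"
    and hom_poset: "\<lbrakk>X \<in> Obj C; Y \<in> Obj C\<rbrakk> \<Longrightarrow> poset_on (hom C X Y) (\<sqsubseteq>)"
    and comp_mono: "\<lbrakk>f \<in> hom C X Y; f' \<in> hom C X Y; g \<in> hom C Y Z; g' \<in> hom C Y Z;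
        f \<sqsubseteq> f'; g \<sqsubseteq> g'\<rbrakk> \<Longrightarrow> g \<cdot> f \<sqsubseteq> g' \<cdot> f'"

locale pos_functor = D: pos_category D + C: pos_category C
  for D :: "('d, 'e) pos_cat" and C :: "('o, 'm) pos_cat"
    and F\<^sub>o :: "'d \<Rightarrow> 'o" and F\<^sub>a :: "'e \<Rightarrow> 'm" +
  assumes obj: "d \<in> Obj D \<Longrightarrow> F\<^sub>o d \<in> Obj C"
    and arr: "a \<in> hom D d d' \<Longrightarrow> F\<^sub>a a \<in> hom C (F\<^sub>o d) (F\<^sub>o d')"
    and id: "d \<in> Obj D \<Longrightarrow> F\<^sub>a (Id D d) = Id C (F\<^sub>o d)"
    and comp: "\<lbrakk>a \<in> hom D d d'; b \<in> hom D d' d''\<rbrakk>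
      \<Longrightarrow> F\<^sub>a (b \<cdot>\<^bsub>D\<^esub> a) = F\<^sub>a b \<cdot>\<^bsub>C\<^esub> F\<^sub>a a"
    and mono: "\<lbrakk>d \<in> Obj D; d' \<in> Obj D\<rbrakk> \<Longrightarrow> monotone_on (hom D d d') (Leq D) (Leq C) F\<^sub>a"

text \<open>A weight is an enriched functor from \<open>D\<close> to posets: it sends \<open>d\<close> to the poset \<open>W d\<close>
  ordered by \<open>leW d\<close>, and an arrow \<open>a\<close> to the monotone map \<open>act a\<close>. The last axiom is
  monotonicity of the action in the arrow, for the pointwise order of maps.\<close>

locale pos_weight = D: pos_category D
  for D :: "('d, 'e) pos_cat"
    and W :: "'d \<Rightarrow> 'w set" and leW :: "'d \<Rightarrow> 'w \<Rightarrow> 'w \<Rightarrow> bool" and act :: "'e \<Rightarrow> 'w \<Rightarrow> 'w" +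
  assumes poset: "d \<in> Obj D \<Longrightarrow> poset_on (W d) (leW d)"
    and act_in: "\<lbrakk>a \<in> hom D d d'; w \<in> W d\<rbrakk> \<Longrightarrow> act a w \<in> W d'"
    and act_mono: "a \<in> hom D d d' \<Longrightarrow> monotone_on (W d) (leW d) (leW d') (act a)"
    and act_id: "\<lbrakk>d \<in> Obj D; w \<in> W d\<rbrakk> \<Longrightarrow> act (Id D d) w = w"
    and act_comp: "\<lbrakk>a \<in> hom D d d'; b \<in> hom D d' d''; w \<in> W d\<rbrakk>
      \<Longrightarrow> act (b \<cdot>\<^bsub>D\<^esub> a) w = act b (act a w)"
    and act_mono_arr: "\<lbrakk>a \<in> hom D d d'; b \<in> hom D d d'; a \<sqsubseteq>\<^bsub>D\<^esub> b; w \<in> W d\<rbrakk>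
      \<Longrightarrow> leW d' (act a w) (act b w)"

text \<open>Enriched natural transformations from the weight to \<open>hom C Z (F -)\<close>.\<close>

definition weighted_cone ::
  "('d, 'e) pos_cat \<Rightarrow> ('o, 'm) pos_cat \<Rightarrow> ('d \<Rightarrow> 'o) \<Rightarrow> ('e \<Rightarrow> 'm) \<Rightarrow>
   ('d \<Rightarrow> 'w set) \<Rightarrow> ('d \<Rightarrow> 'w \<Rightarrow> 'w \<Rightarrow> bool) \<Rightarrow> ('e \<Rightarrow> 'w \<Rightarrow> 'w) \<Rightarrow> 'o \<Rightarrow> ('d \<Rightarrow> 'w \<Rightarrow> 'm) \<Rightarrow> bool" where
  "weighted_cone D C F\<^sub>o F\<^sub>a W leW act Z \<mu> \<longleftrightarrow>
     Z \<in> Obj C \<and>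
     (\<forall>d\<in>Obj D. (\<forall>w\<in>W d. \<mu> d w \<in> hom C Z (F\<^sub>o d)) \<and> monotone_on (W d) (leW d) (Leq C) (\<mu> d)) \<and>
     (\<forall>d\<in>Obj D. \<forall>d'\<in>Obj D. \<forall>a\<in>hom D d d'. \<forall>w\<in>W d. \<mu> d' (act a w) = F\<^sub>a a \<cdot>\<^bsub>C\<^esub> \<mu> d w)"

text \<open>The universal property says that precomposition with the cone \<open>\<pi>\<close> is an isomorphism of posets
  from \<open>hom C Z L\<close> to the poset of weighted cones with vertex \<open>Z\<close>: it is surjective and reflects
  the (componentwise) order.\<close>

definition is_weighted_limit ::
  "('d, 'e) pos_cat \<Rightarrow> ('o, 'm) pos_cat \<Rightarrow> ('d \<Rightarrow> 'o) \<Rightarrow> ('e \<Rightarrow> 'm) \<Rightarrow>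
   ('d \<Rightarrow> 'w set) \<Rightarrow> ('d \<Rightarrow> 'w \<Rightarrow> 'w \<Rightarrow> bool) \<Rightarrow> ('e \<Rightarrow> 'w \<Rightarrow> 'w) \<Rightarrow> 'o \<Rightarrow> ('d \<Rightarrow> 'w \<Rightarrow> 'm) \<Rightarrow> bool" where
  "is_weighted_limit D C F\<^sub>o F\<^sub>a W leW act L \<pi> \<longleftrightarrow>
     weighted_cone D C F\<^sub>o F\<^sub>a W leW act L \<pi> \<and>
     (\<forall>Z \<mu>. weighted_cone D C F\<^sub>o F\<^sub>a W leW act Z \<mu> \<longrightarrow>
        (\<exists>u\<in>hom C Z L. \<forall>d\<in>Obj D. \<forall>w\<in>W d. \<pi> d w \<cdot>\<^bsub>C\<^esub> u = \<mu> d w)) \<and>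
     (\<forall>Z\<in>Obj C. \<forall>u\<in>hom C Z L. \<forall>v\<in>hom C Z L.
        (\<forall>d\<in>Obj D. \<forall>w\<in>W d. \<pi> d w \<cdot>\<^bsub>C\<^esub> u \<sqsubseteq>\<^bsub>C\<^esub> \<pi> d w \<cdot>\<^bsub>C\<^esub> v) \<longrightarrow> u \<sqsubseteq>\<^bsub>C\<^esub> v)"

text \<open>A weight is finite if its indexing category has finitely many objects and arrows and all its
  values are finite posets. Up to isomorphism, every finite weight has objects, arrows and elements
  coded by natural numbers. Finite products and equalizers (constant singleton weights) and powers
  by finite posets (one-object indexing category) are special cases.\<close>

definition has_finite_limits :: "('o, 'm) pos_cat \<Rightarrow> bool" where
  "has_finite_limits C \<longleftrightarrow>
     (\<forall>(D :: (nat, nat) pos_cat) F\<^sub>o F\<^sub>a (W :: nat \<Rightarrow> nat set) leW act.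
        finite (Obj D) \<and> finite (Arr D) \<and> (\<forall>d\<in>Obj D. finite (W d)) \<and>
        pos_functor D C F\<^sub>o F\<^sub>a \<and> pos_weight D W leW act \<longrightarrow>
        (\<exists>L \<pi>. is_weighted_limit D C F\<^sub>o F\<^sub>a W leW act L \<pi>))"

definition ff_morphism :: "('o, 'm) pos_cat \<Rightarrow> 'm \<Rightarrow> bool" where
  "ff_morphism C m \<longleftrightarrow> m \<in> Arr C \<and>
     (\<forall>Z\<in>Obj C. \<forall>f\<in>hom C Z (Dom C m). \<forall>g\<in>hom C Z (Dom C m).
        m \<cdot>\<^bsub>C\<^esub> f \<sqsubseteq>\<^bsub>C\<^esub> m \<cdot>\<^bsub>C\<^esub> g \<longrightarrow> f \<sqsubseteq>\<^bsub>C\<^esub> g)"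

text \<open>A square of posets with \<open>h : P \<rightarrow> A\<close>, \<open>k : P \<rightarrow> B\<close>, \<open>f : A \<rightarrow> S\<close>, \<open>g : B \<rightarrow> S\<close> is a pullback if
  the comparison with the standard pullback (the fibre product with the componentwise order) is an
  isomorphism of posets. The order of \<open>S\<close> plays no role.\<close>

definition poset_pullback ::
  "'p set \<Rightarrow> ('p \<Rightarrow> 'p \<Rightarrow> bool) \<Rightarrow> 'a set \<Rightarrow> ('a \<Rightarrow> 'a \<Rightarrow> bool) \<Rightarrow> 'b set \<Rightarrow> ('b \<Rightarrow> 'b \<Rightarrow> bool) \<Rightarrow>
   ('p \<Rightarrow> 'a) \<Rightarrow> ('p \<Rightarrow> 'b) \<Rightarrow> ('a \<Rightarrow> 's) \<Rightarrow> ('b \<Rightarrow> 's) \<Rightarrow> bool" where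
  "poset_pullback P leP A leA B leB h k f g \<longleftrightarrow>
     bij_betw (\<lambda>x. (h x, k x)) P {(a, b). a \<in> A \<and> b \<in> B \<and> f a = g b} \<and>
     (\<forall>x\<in>P. \<forall>y\<in>P. leP x y \<longleftrightarrow> leA (h x) (h y) \<and> leB (k x) (k y))"

definition orthogonal :: "('o, 'm) pos_cat \<Rightarrow> 'm \<Rightarrow> 'm \<Rightarrow> bool" where
  "orthogonal C e m \<longleftrightarrow>
     poset_pullback
       (hom C (Cod C e) (Dom C m)) (Leq C)
       (hom C (Dom C e) (Dom C m)) (Leq C)
       (hom C (Cod C e) (Cod C m)) (Leq C)
       (\<lambda>d. d \<cdot>\<^bsub>C\<^esub> e) (\<lambda>d. m \<cdot>\<^bsub>C\<^esub> d) (\<lambda>u. m \<cdot>\<^bsub>C\<^esub> u) (\<lambda>v. v \<cdot>\<^bsub>C\<^esub> e)"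

definition so_morphism :: "('o, 'm) pos_cat \<Rightarrow> 'm \<Rightarrow> bool" where
  "so_morphism C e \<longleftrightarrow> e \<in> Arr C \<and> (\<forall>m. ff_morphism C m \<longrightarrow> orthogonal C e m)"

definition has_so_ff_factorizations :: "('o, 'm) pos_cat \<Rightarrow> bool" where
  "has_so_ff_factorizations C \<longleftrightarrow>
     (\<forall>f\<in>Arr C. \<exists>e m. so_morphism C e \<and> ff_morphism C m \<and>
        Dom C e = Dom C f \<and> Cod C e = Dom C m \<and> Cod C m = Cod C f \<and> f = m \<cdot>\<^bsub>C\<^esub> e)"

text \<open>\<open>p : P \<rightarrow> X\<close> and \<open>q : P \<rightarrow> Y\<close> form a pullback of \<open>f : X \<rightarrow> S\<close> and \<open>g : Y \<rightarrow> S\<close>. Uniqueness of the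
  factorization follows from joint order-monicity.\<close>

definition is_pullback :: "('o, 'm) pos_cat \<Rightarrow> 'm \<Rightarrow> 'm \<Rightarrow> 'm \<Rightarrow> 'm \<Rightarrow> bool" where
  "is_pullback C p q f g \<longleftrightarrow>
     p \<in> Arr C \<and> q \<in> Arr C \<and> f \<in> Arr C \<and> g \<in> Arr C \<and>
     Dom C p = Dom C q \<and> Cod C p = Dom C f \<and> Cod C q = Dom C g \<and> Cod C f = Cod C g \<and>
     f \<cdot>\<^bsub>C\<^esub> p = g \<cdot>\<^bsub>C\<^esub> q \<and>
     (\<forall>Z\<in>Obj C. \<forall>x\<in>hom C Z (Dom C f). \<forall>y\<in>hom C Z (Dom C g). f \<cdot>\<^bsub>C\<^esub> x = g \<cdot>\<^bsub>C\<^esub> y \<longrightarrow>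
        (\<exists>u\<in>hom C Z (Dom C p). p \<cdot>\<^bsub>C\<^esub> u = x \<and> q \<cdot>\<^bsub>C\<^esub> u = y)) \<and>
     (\<forall>Z\<in>Obj C. \<forall>u\<in>hom C Z (Dom C p). \<forall>v\<in>hom C Z (Dom C p).
        p \<cdot>\<^bsub>C\<^esub> u \<sqsubseteq>\<^bsub>C\<^esub> p \<cdot>\<^bsub>C\<^esub> v \<and> q \<cdot>\<^bsub>C\<^esub> u \<sqsubseteq>\<^bsub>C\<^esub> q \<cdot>\<^bsub>C\<^esub> v \<longrightarrow> u \<sqsubseteq>\<^bsub>C\<^esub> v)"

definition so_stable_under_pullback :: "('o, 'm) pos_cat \<Rightarrow> bool" where
  "so_stable_under_pullback C \<longleftrightarrow>
     (\<forall>p q f e. is_pullback C p q f e \<and> so_morphism C e \<longrightarrow> so_morphism C p)"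

definition is_coinserter :: "('o, 'm) pos_cat \<Rightarrow> 'm \<Rightarrow> 'm \<Rightarrow> 'm \<Rightarrow> bool" where
  "is_coinserter C f\<^sub>0 f\<^sub>1 e \<longleftrightarrow>
     f\<^sub>0 \<in> Arr C \<and> f\<^sub>1 \<in> Arr C \<and> e \<in> Arr C \<and>
     Dom C f\<^sub>0 = Dom C f\<^sub>1 \<and> Cod C f\<^sub>0 = Dom C e \<and> Cod C f\<^sub>1 = Dom C e \<and>
     e \<cdot>\<^bsub>C\<^esub> f\<^sub>0 \<sqsubseteq>\<^bsub>C\<^esub> e \<cdot>\<^bsub>C\<^esub> f\<^sub>1 \<and>
     (\<forall>Z\<in>Obj C. \<forall>g\<in>hom C (Dom C e) Z. g \<cdot>\<^bsub>C\<^esub> f\<^sub>0 \<sqsubseteq>\<^bsub>C\<^esub> g \<cdot>\<^bsub>C\<^esub> f\<^sub>1 \<longrightarrow>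
        (\<exists>u\<in>hom C (Cod C e) Z. g = u \<cdot>\<^bsub>C\<^esub> e)) \<and>
     (\<forall>Z\<in>Obj C. \<forall>u\<in>hom C (Cod C e) Z. \<forall>v\<in>hom C (Cod C e) Z.
        u \<cdot>\<^bsub>C\<^esub> e \<sqsubseteq>\<^bsub>C\<^esub> v \<cdot>\<^bsub>C\<^esub> e \<longrightarrow> u \<sqsubseteq>\<^bsub>C\<^esub> v)"

definition effective :: "('o, 'm) pos_cat \<Rightarrow> 'm \<Rightarrow> bool" where
  "effective C e \<longleftrightarrow> (\<exists>f\<^sub>0 f\<^sub>1. is_coinserter C f\<^sub>0 f\<^sub>1 e)"

end

theory Submission
  imports Defs
begin

text \<open>An \<open>so\<close>-morphism \<open>e : A \<rightarrow> B\<close> is the coinserter of its kernel \<open>k\<^sub>0, k\<^sub>1 : K \<rightarrow> A\<close>, the universal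
  pair with \<open>e k\<^sub>0 \<le> e k\<^sub>1\<close>. Suppose \<open>g k\<^sub>0 \<le> g k\<^sub>1\<close>, and factor \<open>\<langle>e, g\<rangle> = m h\<close> through
  \<open>m : I \<rightarrow> B \<times> Z\<close>. Its component \<open>i : I \<rightarrow> B\<close> is an \<open>ff\<close>-morphism: given \<open>i x \<le> i y\<close>, pull \<open>h\<close> back
  along \<open>x\<close> and \<open>y\<close> to lift \<open>x, y\<close>, after restriction along \<open>so\<close>-morphisms, to a pair \<open>x', y'\<close> into
  \<open>A\<close> with \<open>e x' \<le> e y'\<close>. This pair factors through \<open>K\<close>, so \<open>g x' \<le> g y'\<close>. As \<open>so\<close>-morphisms are
  order-epimorphisms, the second components of \<open>m x\<close> and \<open>m y\<close> are comparable too.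
  Finally \<open>e \<bottom> i\<close> yields a section of \<open>i\<close>, and with it the factorization of \<open>g\<close> through \<open>e\<close>.\<close>

section \<open>Rules for weighted cones and weighted limits\<close>

lemma weighted_cone_hom:
  "\<lbrakk>weighted_cone D C F\<^sub>o F\<^sub>a W leW act Z \<mu>; d \<in> Obj D; w \<in> W d\<rbrakk> \<Longrightarrow> \<mu> d w \<in> hom C Z (F\<^sub>o d)"
  by (simp add: weighted_cone_def)

lemma weighted_cone_mono:
  "\<lbrakk>weighted_cone D C F\<^sub>o F\<^sub>a W leW act Z \<mu>; d \<in> Obj D; v \<in> W d; w \<in> W d; leW d v w\<rbrakk>
    \<Longrightarrow> Leq C (\<mu> d v) (\<mu> d w)"
  by (simp add: weighted_cone_def monotone_on_def)

lemma weighted_cone_natural: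
  "\<lbrakk>weighted_cone D C F\<^sub>o F\<^sub>a W leW act Z \<mu>; d \<in> Obj D; d' \<in> Obj D; a \<in> hom D d d'; w \<in> W d\<rbrakk>
    \<Longrightarrow> \<mu> d' (act a w) = Comp C (F\<^sub>a a) (\<mu> d w)"
  unfolding weighted_cone_def by blast

lemma weighted_limit_cone:
  "is_weighted_limit D C F\<^sub>o F\<^sub>a W leW act L \<pi> \<Longrightarrow> weighted_cone D C F\<^sub>o F\<^sub>a W leW act L \<pi>"
  by (simp add: is_weighted_limit_def)

lemma weighted_limit_factor:
  "\<lbrakk>is_weighted_limit D C F\<^sub>o F\<^sub>a W leW act L \<pi>; weighted_cone D C F\<^sub>o F\<^sub>a W leW act Z \<mu>\<rbrakk>
    \<Longrightarrow> \<exists>u\<in>hom C Z L. \<forall>d\<in>Obj D. \<forall>w\<in>W d. Comp C (\<pi> d w) u = \<mu> d w"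
  unfolding is_weighted_limit_def by blast

lemma weighted_limit_leqI:
  assumes "is_weighted_limit D C F\<^sub>o F\<^sub>a W leW act L \<pi>"
    and "Z \<in> Obj C" "u \<in> hom C Z L" "v \<in> hom C Z L"
    and "\<And>d w. \<lbrakk>d \<in> Obj D; w \<in> W d\<rbrakk> \<Longrightarrow> Leq C (Comp C (\<pi> d w) u) (Comp C (\<pi> d w) v)"
  shows "Leq C u v"
  using assms unfolding is_weighted_limit_def by blast

section \<open>Index categories and weights for products and inserters\<close>

text \<open>Objects \<open>0, 1\<close> with their identities \<open>0, 1\<close>; every further arrow goes from \<open>0\<close> to \<open>1\<close>.\<close>

definition parallel_arrows :: "nat set \<Rightarrow> (nat, nat) pos_cat" where
  "parallel_arrows S = \<lparr>Obj = {0, 1}, Arr = {0, 1} \<union> S,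
     Dom = (\<lambda>a. if a = 1 then 1 else 0), Cod = (\<lambda>a. if a = 0 then 0 else 1),
     Id = (\<lambda>d. d), Comp = (\<lambda>b a. if b \<le> 1 then a else b), Leq = (=)\<rparr>"

lemma parallel_arrows_simps [simp]:
  "Obj (parallel_arrows S) = {0, 1}"
  "Arr (parallel_arrows S) = {0, 1} \<union> S"
  "Dom (parallel_arrows S) a = (if a = 1 then 1 else 0)"
  "Cod (parallel_arrows S) a = (if a = 0 then 0 else 1)"
  "Id (parallel_arrows S) d = d"
  "Leq (parallel_arrows S) = (=)"
  "Comp (parallel_arrows S) b a = (if b \<le> 1 then a else b)"
  by (simp_all add: parallel_arrows_def)

lemma hom_parallel_arrows:
  "a \<in> hom (parallel_arrows S) d d' \<longleftrightarrow> a \<in> {0, 1} \<union> S \<and>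
     d = (if a = 1 then 1 else 0) \<and> d' = (if a = 0 then 0 else 1)"
  by (auto simp: hom_def parallel_arrows_def)

lemma hom_parallel_arrowsE:
  assumes "a \<in> hom (parallel_arrows S) d d'"
  obtains (id0) "a = 0" "d = 0" "d' = 0" | (id1) "a = 1" "d = 1" "d' = 1"
    | (other) "a \<in> S" "a > 1" "d = 0" "d' = 1"
  using assms by (cases "a = 0"; cases "a = 1") (auto simp: hom_parallel_arrows)

text \<open>No two non-identity arrows are composable, so every composite has an identity factor and
  \<open>Comp\<close> returns the other one. As an operation on all natural numbers
  \<open>Comp\<close> is already associative.\<close>

lemma pos_category_parallel_arrows: "pos_category (parallel_arrows S)"
proof
  fix f assume "f \<in> Arr (parallel_arrows S)"
  show "Dom (parallel_arrows S) f \<in> Obj (parallel_arrows S)"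
    and "Cod (parallel_arrows S) f \<in> Obj (parallel_arrows S)"
    by simp_all
next
  fix X assume "X \<in> Obj (parallel_arrows S)"
  then show "Id (parallel_arrows S) X \<in> hom (parallel_arrows S) X X"
    by (auto simp: hom_parallel_arrows)
next
  fix f g X Y Z assume "f \<in> hom (parallel_arrows S) X Y" "g \<in> hom (parallel_arrows S) Y Z"
  then show "g \<cdot>\<^bsub>parallel_arrows S\<^esub> f \<in> hom (parallel_arrows S) X Z"
    by (elim hom_parallel_arrowsE) (simp_all add: hom_parallel_arrows)
next
  fix f X Y assume f: "f \<in> hom (parallel_arrows S) X Y"
  then show "Id (parallel_arrows S) Y \<cdot>\<^bsub>parallel_arrows S\<^esub> f = f"
    by (rule hom_parallel_arrowsE) simp_all
  from f show "f \<cdot>\<^bsub>parallel_arrows S\<^esub> Id (parallel_arrows S) X = f"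
    by (rule hom_parallel_arrowsE) simp_all
next
  fix f g h W X Y Z
  show "(h \<cdot>\<^bsub>parallel_arrows S\<^esub> g) \<cdot>\<^bsub>parallel_arrows S\<^esub> f =
      h \<cdot>\<^bsub>parallel_arrows S\<^esub> (g \<cdot>\<^bsub>parallel_arrows S\<^esub> f)"
    by simp
next
  fix X Y
  show "poset_on (hom (parallel_arrows S) X Y) (Leq (parallel_arrows S))"
    by (simp add: poset_on_def reflp_on_def transp_on_def antisymp_on_def)
qed simp

text \<open>The weights for products (\<open>S = {}\<close>, \<open>n = 0\<close>) and inserters (\<open>S = {2, 3}\<close>, \<open>n = 1\<close>): a point
  at \<open>0\<close> and the chain \<open>{0..n}\<close> at \<open>1\<close>, where the arrows \<open>2\<close> and \<open>3\<close> pick out the elements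
  \<open>0\<close> and \<open>1\<close>.\<close>

lemma pos_weight_parallel_arrows:
  assumes "S = {} \<and> n = 0 \<or> S = {2, 3} \<and> n = (1::nat)"
  shows "pos_weight (parallel_arrows S) (\<lambda>d. if d = 0 then {0} else {0..n}) (\<lambda>_. (\<le>))
    (\<lambda>a w. if a = 2 then 0 else if a = 3 then 1 else w)"
proof -
  interpret pos_category "parallel_arrows S"
    by (rule pos_category_parallel_arrows)
  let ?W = "\<lambda>d::nat. if d = 0 then {0} else {0..n}"
  let ?act = "\<lambda>(a::nat) w::nat. if a = 2 then 0 else if a = 3 then 1 else w"
  have poset: "poset_on A (\<le>)" for A :: "nat set"
    by (auto simp: poset_on_def reflp_on_def transp_on_def antisymp_on_def)
  have other: "(a = 2 \<or> a = 3) \<and> n = 1" if "a \<in> S" for a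
    using assms that by auto
  show ?thesis
  proof unfold_locales
    fix d
    show "poset_on (?W d) (\<le>)"
      by (rule poset)
  next
    fix a d d' w assume "a \<in> hom (parallel_arrows S) d d'" "w \<in> ?W d"
    then show "?act a w \<in> ?W d'"
      by (cases rule: hom_parallel_arrowsE) (auto dest: other)
  next
    fix a d d' assume "a \<in> hom (parallel_arrows S) d d'"
    then show "monotone_on (?W d) (\<le>) (\<le>) (?act a)"
      by (cases rule: hom_parallel_arrowsE) (auto simp: monotone_on_def)
  next
    fix a b d d' d'' w
    assume a: "a \<in> hom (parallel_arrows S) d d'" and "b \<in> hom (parallel_arrows S) d' d''"
    from this(2) show "?act (b \<cdot>\<^bsub>parallel_arrows S\<^esub> a) w = ?act b (?act a w)"
    proof (cases rule: hom_parallel_arrowsE)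
      case other
      \<comment> \<open>\<open>b\<close> starts at the object \<open>0\<close>, and the only arrow
        into \<open>0\<close> is its identity.\<close>
      then have "a = 0"
        using a by (auto simp: hom_parallel_arrows split: if_splits)
      then show ?thesis
        using other by simp
    qed simp_all
  next
    fix d w assume "d \<in> Obj (parallel_arrows S)"
    then have "d = 0 \<or> d = 1"
      by simp
    then show "?act (Id (parallel_arrows S) d) w = w"
      by (elim disjE) simp_all
  qed simp
qed

section \<open>Order calculus, diagonal fill-ins and two-object diagrams\<close>

context pos_category
begin

lemma hom_objD:
  assumes "f \<in> hom C X Y"
  shows "X \<in> Obj C" "Y \<in> Obj C"
  using assms dom_obj cod_obj by (auto simp: hom_def)

lemma leq_refl: "f \<in> hom C X Y \<Longrightarrow> f \<sqsubseteq> f"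
  using hom_poset[of X Y] hom_objD[of f X Y] by (auto simp: poset_on_def reflp_on_def)

lemma leq_antisym:
  "\<lbrakk>f \<in> hom C X Y; g \<in> hom C X Y; f \<sqsubseteq> g; g \<sqsubseteq> f\<rbrakk> \<Longrightarrow> f = g"
  using hom_poset[of X Y] hom_objD[of f X Y] by (auto simp: poset_on_def antisymp_on_def)

lemma comp_mono_right:
  "\<lbrakk>f \<in> hom C X Y; f' \<in> hom C X Y; g \<in> hom C Y Z; f \<sqsubseteq> f'\<rbrakk> \<Longrightarrow> g \<cdot> f \<sqsubseteq> g \<cdot> f'"
  using comp_mono leq_refl by blast

lemma comp_mono_left:
  "\<lbrakk>f \<in> hom C X Y; g \<in> hom C Y Z; g' \<in> hom C Y Z; g \<sqsubseteq> g'\<rbrakk> \<Longrightarrow> g \<cdot> f \<sqsubseteq> g' \<cdot> f"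
  using comp_mono leq_refl by blast

lemma ff_morphismD:
  assumes "ff_morphism C m" "m \<in> hom C X Y" "f \<in> hom C Z X" "g \<in> hom C Z X" "m \<cdot> f \<sqsubseteq> m \<cdot> g"
  shows "f \<sqsubseteq> g"
  using assms hom_objD[of f Z X] by (auto simp: ff_morphism_def hom_def)

text \<open>Surjectivity of the comparison map in \<open>orthogonal\<close> is exactly the existence
  of diagonals.\<close>

lemma so_morphism_fill:
  assumes "so_morphism C e" "ff_morphism C m" "e \<in> hom C A B" "m \<in> hom C X Y"
    and "a \<in> hom C A X" "b \<in> hom C B Y" "m \<cdot> a = b \<cdot> e"
  obtains d where "d \<in> hom C B X" "d \<cdot> e = a" "m \<cdot> d = b"
proof -
  have dc: "Dom C e = A" "Cod C e = B" "Dom C m = X" "Cod C m = Y"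
    using assms by (auto simp: hom_def)
  have "orthogonal C e m"
    using assms by (simp add: so_morphism_def)
  then have "(\<lambda>d. (d \<cdot> e, m \<cdot> d)) ` hom C B X =
      {(a, b). a \<in> hom C A X \<and> b \<in> hom C B Y \<and> m \<cdot> a = b \<cdot> e}"
    unfolding orthogonal_def poset_pullback_def dc bij_betw_def by blast
  moreover have "(a, b) \<in> {(a, b). a \<in> hom C A X \<and> b \<in> hom C B Y \<and> m \<cdot> a = b \<cdot> e}"
    using assms by simp
  ultimately have "(a, b) \<in> (\<lambda>d. (d \<cdot> e, m \<cdot> d)) ` hom C B X"
    by simp
  then show thesis
    using that by auto
qed

text \<open>One functor serves both shapes. For \<open>S = {}\<close> no arrow is sent to
  \<open>u\<close> or \<open>v\<close>, hence the guard on their typing; for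
  \<open>S = {2, 3}\<close> the arrows \<open>2\<close> and \<open>3\<close> go to \<open>u\<close>
  and \<open>v\<close>. Monotonicity reduces to reflexivity, the order on arrows of the index
  category being equality.\<close>

lemma pos_functor_parallel_arrows:
  assumes X: "X \<in> Obj C" and Y: "Y \<in> Obj C"
    and uv: "S \<noteq> {} \<Longrightarrow> u \<in> hom C X Y \<and> v \<in> hom C X Y"
  shows "pos_functor (parallel_arrows S) C (\<lambda>d. if d = 0 then X else Y)
    (\<lambda>a. if a = 0 then Id C X else if a = 1 then Id C Y else if a = 2 then u else v)"
proof -
  interpret D: pos_category "parallel_arrows S"
    by (rule pos_category_parallel_arrows)
  have ids: "Id C X \<in> hom C X X" "Id C Y \<in> hom C Y Y"
    using X Y by (auto intro: id_hom)
  let ?F = "\<lambda>a::nat. if a = 0 then Id C X else if a = 1 then Id C Y else if a = 2 then u else v"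
  have uv': "u \<in> hom C X Y" "v \<in> hom C X Y" if "a \<in> S" for a
    using uv that by auto
  have arr: "?F a \<in> hom C (if d = 0 then X else Y) (if d' = 0 then X else Y)"
    if "a \<in> hom (parallel_arrows S) d d'" for a d d'
    using that by (cases rule: hom_parallel_arrowsE) (simp_all add: ids uv')
  show ?thesis
  proof unfold_locales
    fix a d d' assume "a \<in> hom (parallel_arrows S) d d'"
    then show "?F a \<in> hom C (if d = 0 then X else Y) (if d' = 0 then X else Y)"
      by (rule arr)
  next
    fix a b d d' d''
    assume a: "a \<in> hom (parallel_arrows S) d d'" and b: "b \<in> hom (parallel_arrows S) d' d''"
    show "?F (b \<cdot>\<^bsub>parallel_arrows S\<^esub> a) = ?F b \<cdot> ?F a"
      using b
    proof (cases rule: hom_parallel_arrowsE)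
      case other
      then have "a = 0"
        using a by (auto simp: hom_parallel_arrows split: if_splits)
      then show ?thesis
        using other id_right[OF arr[OF b]] by simp
    qed (use id_left[OF arr[OF a]] in simp_all)
  next
    fix d d'
    show "monotone_on (hom (parallel_arrows S) d d') (Leq (parallel_arrows S)) (\<sqsubseteq>) ?F"
      unfolding monotone_on_def using leq_refl[OF arr] by simp
  qed (use X Y in auto)
qed

end

section \<open>Products, inserters, comma objects and pullbacks\<close>

locale finitely_complete_pos_category = pos_category +
  assumes finite_limits: "has_finite_limits C"
begin

lemma weighted_limit_exists:
  fixes D :: "(nat, nat) pos_cat" and W :: "nat \<Rightarrow> nat set"
  assumes "finite (Obj D)" "finite (Arr D)" "\<forall>d\<in>Obj D. finite (W d)"
    and "pos_functor D C F\<^sub>o F\<^sub>a" "pos_weight D W leW act"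
  shows "\<exists>L \<pi>. is_weighted_limit D C F\<^sub>o F\<^sub>a W leW act L \<pi>"
  by (rule finite_limits[unfolded has_finite_limits_def, THEN spec, THEN spec, THEN spec,
        THEN spec, THEN spec, THEN spec, THEN mp]) (intro conjI assms)

text \<open>With a one-point weight on two objects and their identities, a cone with vertex
  \<open>Z\<close> is just a pair of morphisms out of \<open>Z\<close>.\<close>

lemma binary_product:
  assumes X: "X \<in> Obj C" and Y: "Y \<in> Obj C"
  obtains p P q where "p \<in> hom C P X" "q \<in> hom C P Y"
    and "\<And>Z f g. \<lbrakk>f \<in> hom C Z X; g \<in> hom C Z Y\<rbrakk> \<Longrightarrow> \<exists>u\<in>hom C Z P. p \<cdot> u = f \<and> q \<cdot> u = g"
    and "\<And>Z u v. \<lbrakk>u \<in> hom C Z P; v \<in> hom C Z P; p \<cdot> u \<sqsubseteq> p \<cdot> v; q \<cdot> u \<sqsubseteq> q \<cdot> v\<rbrakk> \<Longrightarrow> u \<sqsubseteq> v"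
proof -
  let ?D = "parallel_arrows {}"
  let ?Fo = "\<lambda>d::nat. if d = 0 then X else Y"
  \<comment> \<open>The two \<open>undefined\<close> stand in the places of \<open>u\<close> and
    \<open>v\<close> in \<open>pos_functor_parallel_arrows\<close>; no arrow of
    \<open>parallel_arrows {}\<close> reaches them.\<close>
  let ?Fa = "\<lambda>a::nat. if a = 0 then Id C X else if a = 1 then Id C Y
    else if a = 2 then undefined else undefined"
  let ?W = "\<lambda>d::nat. if d = 0 then {0} else {0..0::nat}"
  let ?act = "\<lambda>(a::nat) w::nat. if a = 2 then 0 else if a = 3 then 1 else w"
  have fin: "finite (Obj ?D)" "finite (Arr ?D)" "\<forall>d\<in>Obj ?D. finite (?W d)"
    by auto
  have F: "pos_functor ?D C ?Fo ?Fa"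
    using X Y by (rule pos_functor_parallel_arrows) simp
  have W: "pos_weight ?D ?W (\<lambda>_. (\<le>)) ?act"
    by (rule pos_weight_parallel_arrows) simp
  obtain L \<pi> where lim: "is_weighted_limit ?D C ?Fo ?Fa ?W (\<lambda>_. (\<le>)) ?act L \<pi>"
    using weighted_limit_exists[OF fin F W] by (elim exE) (rule that)
  show thesis
  proof
    show "\<pi> 0 0 \<in> hom C L X" "\<pi> 1 0 \<in> hom C L Y"
      using weighted_cone_hom[OF weighted_limit_cone[OF lim], of 0 0]
        weighted_cone_hom[OF weighted_limit_cone[OF lim], of 1 0] by simp_all
  next
    fix Z f g assume f: "f \<in> hom C Z X" and g: "g \<in> hom C Z Y"
    have "weighted_cone ?D C ?Fo ?Fa ?W (\<lambda>_. (\<le>)) ?act Z (\<lambda>d w. if d = 0 then f else g)"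
      unfolding weighted_cone_def
    proof (intro conjI ballI)
      show "Z \<in> Obj C"
        using hom_objD[OF f] by simp
    next
      fix d w assume "d \<in> Obj ?D" "w \<in> ?W d"
      then show "(if d = 0 then f else g) \<in> hom C Z (?Fo d)"
        using f g by simp
    next
      fix d assume "d \<in> Obj ?D"
      show "monotone_on (?W d) (\<le>) (\<sqsubseteq>) (\<lambda>w. if d = 0 then f else g)"
        using leq_refl[OF f] leq_refl[OF g] by (simp add: monotone_on_def)
    next
      fix d d' a w assume "a \<in> hom ?D d d'"
      then show "(if d' = 0 then f else g) = ?Fa a \<cdot> (if d = 0 then f else g)"
        by (cases rule: hom_parallel_arrowsE) (simp_all add: id_left[OF f] id_left[OF g])
    qed
    from weighted_limit_factor[OF lim this]
    show "\<exists>u\<in>hom C Z L. \<pi> 0 0 \<cdot> u = f \<and> \<pi> 1 0 \<cdot> u = g"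
      by simp
  next
    fix Z u v
    assume u: "u \<in> hom C Z L" and v: "v \<in> hom C Z L"
      and "\<pi> 0 0 \<cdot> u \<sqsubseteq> \<pi> 0 0 \<cdot> v" "\<pi> 1 0 \<cdot> u \<sqsubseteq> \<pi> 1 0 \<cdot> v"
    then show "u \<sqsubseteq> v"
      by (intro weighted_limit_leqI[OF lim hom_objD(1)[OF u] u v]) (auto split: if_splits)
  qed
qed

text \<open>A cone for the chain weight amounts to some \<open>x\<close> with
  \<open>u \<cdot> x \<sqsubseteq> v \<cdot> x\<close>: naturality in the arrows \<open>2\<close>
  and \<open>3\<close> identifies the two components at the object \<open>1\<close>, and
  monotonicity along \<open>0 \<le> 1\<close> orders them.\<close>

lemma inserter:
  assumes u: "u \<in> hom C X Y" and v: "v \<in> hom C X Y"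
  obtains i L where "i \<in> hom C L X" "ff_morphism C i" "u \<cdot> i \<sqsubseteq> v \<cdot> i"
    and "\<And>Z x. \<lbrakk>x \<in> hom C Z X; u \<cdot> x \<sqsubseteq> v \<cdot> x\<rbrakk> \<Longrightarrow> \<exists>y\<in>hom C Z L. i \<cdot> y = x"
proof -
  let ?D = "parallel_arrows {2, 3}"
  let ?Fo = "\<lambda>d::nat. if d = 0 then X else Y"
  let ?Fa = "\<lambda>a::nat. if a = 0 then Id C X else if a = 1 then Id C Y
    else if a = 2 then u else v"
  let ?W = "\<lambda>d::nat. if d = 0 then {0} else {0..1::nat}"
  let ?act = "\<lambda>(a::nat) w::nat. if a = 2 then 0 else if a = 3 then 1 else w"
  have fin: "finite (Obj ?D)" "finite (Arr ?D)" "\<forall>d\<in>Obj ?D. finite (?W d)"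
    by auto
  have F: "pos_functor ?D C ?Fo ?Fa"
    using hom_objD[OF u] u v by (intro pos_functor_parallel_arrows) auto
  have W: "pos_weight ?D ?W (\<lambda>_. (\<le>)) ?act"
    by (rule pos_weight_parallel_arrows) simp
  obtain L \<pi> where lim: "is_weighted_limit ?D C ?Fo ?Fa ?W (\<lambda>_. (\<le>)) ?act L \<pi>"
    using weighted_limit_exists[OF fin F W] by (elim exE) (rule that)
  note cone = weighted_limit_cone[OF lim]
  have i: "\<pi> 0 0 \<in> hom C L X"
    using weighted_cone_hom[OF cone, of 0 0] by simp
  have \<pi>0: "\<pi> 1 0 = u \<cdot> \<pi> 0 0"
    using weighted_cone_natural[OF cone, of 0 1 2 0] by (simp add: hom_parallel_arrows)
  have \<pi>1: "\<pi> 1 1 = v \<cdot> \<pi> 0 0"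
    using weighted_cone_natural[OF cone, of 0 1 3 0] by (simp add: hom_parallel_arrows)
  show thesis
  proof
    show "\<pi> 0 0 \<in> hom C L X"
      by (rule i)
    have "\<pi> 1 0 \<sqsubseteq> \<pi> 1 1"
      by (rule weighted_cone_mono[OF cone]) simp_all
    then show "u \<cdot> \<pi> 0 0 \<sqsubseteq> v \<cdot> \<pi> 0 0"
      by (simp only: \<pi>0 \<pi>1)
  next
    have "f \<sqsubseteq> g" if f: "f \<in> hom C Z L" and g: "g \<in> hom C Z L" and le: "\<pi> 0 0 \<cdot> f \<sqsubseteq> \<pi> 0 0 \<cdot> g"
      for Z f g
    proof -
      \<comment> \<open>Both components at \<open>1\<close> factor through \<open>\<pi> 0 0\<close>,
        so an inequality tested there extends to the whole cone; this makes \<open>\<pi> 0 0\<close>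
        an \<open>ff\<close>-morphism.\<close>
      have post: "(t \<cdot> \<pi> 0 0) \<cdot> f \<sqsubseteq> (t \<cdot> \<pi> 0 0) \<cdot> g" if t: "t \<in> hom C X Y" for t
        using comp_mono_right[OF comp_hom[OF f i] comp_hom[OF g i] t le]
        by (simp add: assoc[OF f i t] assoc[OF g i t])
      show ?thesis
      proof (rule weighted_limit_leqI[OF lim hom_objD(1)[OF f] f g])
        fix d w assume "d \<in> Obj ?D" "w \<in> ?W d"
        then consider "d = 0" "w = 0" | "d = 1" "w = 0" | "d = 1" "w = 1"
          by (cases "d = 0"; cases "w = 0") auto
        then show "\<pi> d w \<cdot> f \<sqsubseteq> \<pi> d w \<cdot> g"
          using le post[OF u] post[OF v] by cases (simp_all only: \<pi>0 \<pi>1)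
      qed
    qed
    then show "ff_morphism C (\<pi> 0 0)"
      using i by (auto simp: ff_morphism_def hom_def)
  next
    fix Z x assume x: "x \<in> hom C Z X" and le: "u \<cdot> x \<sqsubseteq> v \<cdot> x"
    let ?\<mu> = "\<lambda>d w. if d = 0 then x else if w = (0::nat) then u \<cdot> x else v \<cdot> x"
    have ux: "u \<cdot> x \<in> hom C Z Y" and vx: "v \<cdot> x \<in> hom C Z Y"
      by (rule comp_hom[OF x u], rule comp_hom[OF x v])
    have "weighted_cone ?D C ?Fo ?Fa ?W (\<lambda>_. (\<le>)) ?act Z ?\<mu>"
      unfolding weighted_cone_def
    proof (intro conjI ballI)
      show "Z \<in> Obj C"
        using hom_objD[OF x] by simp
    next
      fix d w assume "d \<in> Obj ?D" "w \<in> ?W d"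
      then show "?\<mu> d w \<in> hom C Z (?Fo d)"
        using x ux vx by simp
    next
      fix d assume "d \<in> Obj ?D"
      show "monotone_on (?W d) (\<le>) (\<sqsubseteq>) (?\<mu> d)"
        using le leq_refl[OF x] leq_refl[OF ux] leq_refl[OF vx] by (simp add: monotone_on_def)
    next
      fix d d' a w assume "a \<in> hom ?D d d'" and w: "w \<in> ?W d"
      from this(1) show "?\<mu> d' (?act a w) = ?Fa a \<cdot> ?\<mu> d w"
      proof (cases rule: hom_parallel_arrowsE)
        case other
        then have "a = 2 \<or> a = 3"
          by simp
        then show ?thesis
          using other by (elim disjE) simp_all
      qed (use id_left[OF x] id_left[OF ux] id_left[OF vx] in simp_all)
    qed
    from weighted_limit_factor[OF lim this]
    show "\<exists>y\<in>hom C Z L. \<pi> 0 0 \<cdot> y = x"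
      by auto
  qed
qed

text \<open>Built as the inserter of \<open>f \<cdot> p\<close> and \<open>g \<cdot> q\<close> on
  the product; joint order-monicity combines that of the projections with the inserter being an
  \<open>ff\<close>-morphism. The case \<open>f = g = e\<close> is the kernel of
  \<open>e\<close>.\<close>

lemma comma:
  assumes f: "f \<in> hom C X S" and g: "g \<in> hom C Y S"
  obtains p K q where "p \<in> hom C K X" "q \<in> hom C K Y" "f \<cdot> p \<sqsubseteq> g \<cdot> q"
    and "\<And>Z x y. \<lbrakk>x \<in> hom C Z X; y \<in> hom C Z Y; f \<cdot> x \<sqsubseteq> g \<cdot> y\<rbrakk>
      \<Longrightarrow> \<exists>u\<in>hom C Z K. p \<cdot> u = x \<and> q \<cdot> u = y"
    and "\<And>Z u v. \<lbrakk>u \<in> hom C Z K; v \<in> hom C Z K; p \<cdot> u \<sqsubseteq> p \<cdot> v; q \<cdot> u \<sqsubseteq> q \<cdot> v\<rbrakk> \<Longrightarrow> u \<sqsubseteq> v"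
proof -
  obtain P p q where p: "p \<in> hom C P X" and q: "q \<in> hom C P Y"
    and pair: "\<And>Z f g. \<lbrakk>f \<in> hom C Z X; g \<in> hom C Z Y\<rbrakk> \<Longrightarrow> \<exists>u\<in>hom C Z P. p \<cdot> u = f \<and> q \<cdot> u = g"
    and monic: "\<And>Z u v. \<lbrakk>u \<in> hom C Z P; v \<in> hom C Z P; p \<cdot> u \<sqsubseteq> p \<cdot> v; q \<cdot> u \<sqsubseteq> q \<cdot> v\<rbrakk> \<Longrightarrow> u \<sqsubseteq> v"
    by (rule binary_product[OF hom_objD(1)[OF f] hom_objD(1)[OF g]]) (rule that; assumption)
  obtain K i where i: "i \<in> hom C K P" "ff_morphism C i" "(f \<cdot> p) \<cdot> i \<sqsubseteq> (g \<cdot> q) \<cdot> i"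
    and ins: "\<And>Z x. \<lbrakk>x \<in> hom C Z P; (f \<cdot> p) \<cdot> x \<sqsubseteq> (g \<cdot> q) \<cdot> x\<rbrakk> \<Longrightarrow> \<exists>y\<in>hom C Z K. i \<cdot> y = x"
    by (rule inserter[OF comp_hom[OF p f] comp_hom[OF q g]]) (rule that; assumption)
  show thesis
  proof
    show "p \<cdot> i \<in> hom C K X" "q \<cdot> i \<in> hom C K Y"
      by (rule comp_hom[OF i(1) p], rule comp_hom[OF i(1) q])
    show "f \<cdot> (p \<cdot> i) \<sqsubseteq> g \<cdot> (q \<cdot> i)"
      using i(3) assoc[OF i(1) p f] assoc[OF i(1) q g] by simp
  next
    fix Z x y assume x: "x \<in> hom C Z X" and y: "y \<in> hom C Z Y" and le: "f \<cdot> x \<sqsubseteq> g \<cdot> y"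
    obtain t where t: "t \<in> hom C Z P" "p \<cdot> t = x" "q \<cdot> t = y"
      using pair[OF x y] by auto
    obtain s where s: "s \<in> hom C Z K" "i \<cdot> s = t"
      using ins[OF t(1)] le t assoc[OF t(1) p f] assoc[OF t(1) q g] by auto
    show "\<exists>u\<in>hom C Z K. p \<cdot> i \<cdot> u = x \<and> q \<cdot> i \<cdot> u = y"
      using s t assoc[OF s(1) i(1) p] assoc[OF s(1) i(1) q] by auto
  next
    fix Z u v
    assume u: "u \<in> hom C Z K" and v: "v \<in> hom C Z K"
      and le: "p \<cdot> i \<cdot> u \<sqsubseteq> p \<cdot> i \<cdot> v" "q \<cdot> i \<cdot> u \<sqsubseteq> q \<cdot> i \<cdot> v"
    have "i \<cdot> u \<sqsubseteq> i \<cdot> v"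
      using monic[OF comp_hom[OF u i(1)] comp_hom[OF v i(1)]] le
        assoc[OF u i(1) p] assoc[OF v i(1) p] assoc[OF u i(1) q] assoc[OF v i(1) q] by simp
    then show "u \<sqsubseteq> v"
      using ff_morphismD[OF i(2,1) u v] by blast
  qed
qed

text \<open>The pullback is the inserter of the reverse inequality on the comma object.\<close>

lemma pullback:
  assumes f: "f \<in> hom C X S" and g: "g \<in> hom C Y S"
  obtains P p q where "p \<in> hom C P X" "q \<in> hom C P Y" "is_pullback C p q f g"
proof -
  obtain K p q where p: "p \<in> hom C K X" and q: "q \<in> hom C K Y" and le: "f \<cdot> p \<sqsubseteq> g \<cdot> q"
    and pair: "\<And>Z x y. \<lbrakk>x \<in> hom C Z X; y \<in> hom C Z Y; f \<cdot> x \<sqsubseteq> g \<cdot> y\<rbrakk>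
      \<Longrightarrow> \<exists>u\<in>hom C Z K. p \<cdot> u = x \<and> q \<cdot> u = y"
    and monic: "\<And>Z u v. \<lbrakk>u \<in> hom C Z K; v \<in> hom C Z K; p \<cdot> u \<sqsubseteq> p \<cdot> v; q \<cdot> u \<sqsubseteq> q \<cdot> v\<rbrakk> \<Longrightarrow> u \<sqsubseteq> v"
    by (rule comma[OF f g]) (rule that; assumption)
  have fp: "f \<cdot> p \<in> hom C K S" and gq: "g \<cdot> q \<in> hom C K S"
    by (rule comp_hom[OF p f], rule comp_hom[OF q g])
  obtain L i where i: "i \<in> hom C L K" "ff_morphism C i" "(g \<cdot> q) \<cdot> i \<sqsubseteq> (f \<cdot> p) \<cdot> i"
    and ins: "\<And>Z x. \<lbrakk>x \<in> hom C Z K; (g \<cdot> q) \<cdot> x \<sqsubseteq> (f \<cdot> p) \<cdot> x\<rbrakk> \<Longrightarrow> \<exists>y\<in>hom C Z L. i \<cdot> y = x"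
    by (rule inserter[OF gq fp]) (rule that; assumption)
  have pi: "p \<cdot> i \<in> hom C L X" and qi: "q \<cdot> i \<in> hom C L Y"
    by (rule comp_hom[OF i(1) p], rule comp_hom[OF i(1) q])
  \<comment> \<open>One inequality comes from the comma object, the other from the inserter.\<close>
  have "(f \<cdot> p) \<cdot> i = (g \<cdot> q) \<cdot> i"
    using leq_antisym[OF comp_hom[OF i(1) fp] comp_hom[OF i(1) gq]]
      comp_mono_left[OF i(1) fp gq le] i(3) by blast
  then have eq: "f \<cdot> (p \<cdot> i) = g \<cdot> (q \<cdot> i)"
    using assoc[OF i(1) p f] assoc[OF i(1) q g] by simp
  have ex: "\<exists>u\<in>hom C Z L. p \<cdot> i \<cdot> u = x \<and> q \<cdot> i \<cdot> u = y"
    if x: "x \<in> hom C Z X" and y: "y \<in> hom C Z Y" and xy: "f \<cdot> x = g \<cdot> y" for Z x y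
  proof -
    \<comment> \<open>The equation \<open>f \<cdot> x = g \<cdot> y\<close> is used as two
      inequalities: one gives the factorization through the comma object, the reverse one that
      through the inserter.\<close>
    have refl: "g \<cdot> y \<sqsubseteq> g \<cdot> y"
      using leq_refl[OF comp_hom[OF y g]] .
    obtain t where t: "t \<in> hom C Z K" "p \<cdot> t = x" "q \<cdot> t = y"
      using pair[OF x y] xy refl by auto
    obtain s where s: "s \<in> hom C Z L" "i \<cdot> s = t"
      using ins[OF t(1)] refl xy t assoc[OF t(1) p f] assoc[OF t(1) q g] by auto
    show ?thesis
      using s t assoc[OF s(1) i(1) p] assoc[OF s(1) i(1) q] by auto
  qed
  have mono: "u \<sqsubseteq> v"
    if u: "u \<in> hom C Z L" and v: "v \<in> hom C Z L"
      and uv: "p \<cdot> i \<cdot> u \<sqsubseteq> p \<cdot> i \<cdot> v" "q \<cdot> i \<cdot> u \<sqsubseteq> q \<cdot> i \<cdot> v" for Z u v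
  proof -
    have "i \<cdot> u \<sqsubseteq> i \<cdot> v"
      using monic[OF comp_hom[OF u i(1)] comp_hom[OF v i(1)]] uv
        assoc[OF u i(1) p] assoc[OF v i(1) p] assoc[OF u i(1) q] assoc[OF v i(1) q] by simp
    then show ?thesis
      using ff_morphismD[OF i(2,1) u v] by blast
  qed
  have dc: "Dom C (p \<cdot> i) = L" "Dom C (q \<cdot> i) = L" "Dom C f = X" "Dom C g = Y"
      "Cod C (p \<cdot> i) = X" "Cod C (q \<cdot> i) = Y" "Cod C f = S" "Cod C g = S"
    and arrs: "p \<cdot> i \<in> Arr C" "q \<cdot> i \<in> Arr C" "f \<in> Arr C" "g \<in> Arr C"
    using pi qi f g by (simp_all add: hom_def)
  have "is_pullback C (p \<cdot> i) (q \<cdot> i) f g"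
    unfolding is_pullback_def dc
  proof (intro conjI ballI impI arrs eq refl)
    fix Z x y assume "x \<in> hom C Z X" "y \<in> hom C Z Y" "f \<cdot> x = g \<cdot> y"
    then show "\<exists>u\<in>hom C Z L. p \<cdot> i \<cdot> u = x \<and> q \<cdot> i \<cdot> u = y"
      by (rule ex)
  next
    fix Z u v assume "u \<in> hom C Z L" "v \<in> hom C Z L"
      "p \<cdot> i \<cdot> u \<sqsubseteq> p \<cdot> i \<cdot> v \<and> q \<cdot> i \<cdot> u \<sqsubseteq> q \<cdot> i \<cdot> v"
    then show "u \<sqsubseteq> v"
      by (elim conjE) (rule mono)
  qed
  then show thesis
    using that pi qi by blast
qed

section \<open>Order-epimorphisms, lifting and coinserters\<close>

text \<open>The inequality makes \<open>e\<close> factor through the inserter \<open>i\<close> of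
  \<open>u\<close> and \<open>v\<close>. Since \<open>i\<close> is an \<open>ff\<close>-morphism,
  the diagonal fill-in is a section of \<open>i\<close>, and composing
  \<open>u \<cdot> i \<sqsubseteq> v \<cdot> i\<close> with it gives the claim.\<close>

lemma so_morphism_order_epi:
  assumes so: "so_morphism C e" and e: "e \<in> hom C A B"
    and u: "u \<in> hom C B Z" and v: "v \<in> hom C B Z" and le: "u \<cdot> e \<sqsubseteq> v \<cdot> e"
  shows "u \<sqsubseteq> v"
proof -
  obtain L i where i: "i \<in> hom C L B" "ff_morphism C i" "u \<cdot> i \<sqsubseteq> v \<cdot> i"
    and ins: "\<And>Z x. \<lbrakk>x \<in> hom C Z B; u \<cdot> x \<sqsubseteq> v \<cdot> x\<rbrakk> \<Longrightarrow> \<exists>y\<in>hom C Z L. i \<cdot> y = x"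
    by (rule inserter[OF u v]) (rule that; assumption)
  obtain t where t: "t \<in> hom C A L" "i \<cdot> t = e"
    using ins[OF e le] by auto
  have B: "B \<in> Obj C"
    using hom_objD[OF e] by simp
  have "i \<cdot> t = Id C B \<cdot> e"
    using t id_left[OF e] by simp
  then obtain d where d: "d \<in> hom C B L" "d \<cdot> e = t" "i \<cdot> d = Id C B"
    by (rule so_morphism_fill[OF so i(2) e i(1) t(1) id_hom[OF B]])
  have "(u \<cdot> i) \<cdot> d \<sqsubseteq> (v \<cdot> i) \<cdot> d"
    using comp_mono_left[OF d(1) comp_hom[OF i(1) u] comp_hom[OF i(1) v] i(3)] .
  then show ?thesis
    by (simp add: assoc[OF d(1) i(1) u] assoc[OF d(1) i(1) v] d(3) id_right[OF u] id_right[OF v])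
qed

text \<open>Inequalities between generalized elements of \<open>I\<close> may be tested on elements that lift along
  the \<open>so\<close>-morphism \<open>h\<close>.\<close>

lemma leq_via_so_lifts:
  assumes stable: "so_stable_under_pullback C"
    and h: "so_morphism C h" "h \<in> hom C A I"
    and x: "x \<in> hom C W I" and y: "y \<in> hom C W I" and t: "t \<in> hom C I Z"
    and lifts: "\<And>V s x' y'. \<lbrakk>s \<in> hom C V W; x' \<in> hom C V A; y' \<in> hom C V A;
      x \<cdot> s = h \<cdot> x'; y \<cdot> s = h \<cdot> y'\<rbrakk> \<Longrightarrow> t \<cdot> (h \<cdot> x') \<sqsubseteq> t \<cdot> (h \<cdot> y')"
  shows "t \<cdot> x \<sqsubseteq> t \<cdot> y"
proof -
  obtain V s a where s: "s \<in> hom C V W" and a: "a \<in> hom C V A" and pb: "is_pullback C s a x h"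
    by (rule pullback[OF x h(2)])
  have so_s: "so_morphism C s"
    using stable pb h(1) unfolding so_stable_under_pullback_def by blast
  have xs: "x \<cdot> s = h \<cdot> a"
    using pb by (simp add: is_pullback_def)
  have ys: "y \<cdot> s \<in> hom C V I"
    by (rule comp_hom[OF s y])
  \<comment> \<open>The second pullback is taken along \<open>y \<cdot> s\<close> instead of
    \<open>y\<close>, so that both lifts end up with the common domain \<open>V'\<close>.\<close>
  obtain V' s' b where s': "s' \<in> hom C V' V" and b: "b \<in> hom C V' A"
    and pb': "is_pullback C s' b (y \<cdot> s) h"
    by (rule pullback[OF ys h(2)])
  have so_s': "so_morphism C s'"
    using stable pb' h(1) unfolding so_stable_under_pullback_def by blast
  have ys': "(y \<cdot> s) \<cdot> s' = h \<cdot> b"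
    using pb' by (simp add: is_pullback_def)
  have as': "a \<cdot> s' \<in> hom C V' A"
    by (rule comp_hom[OF s' a])
  have ss': "s \<cdot> s' \<in> hom C V' W"
    by (rule comp_hom[OF s' s])
  have x_lift: "x \<cdot> (s \<cdot> s') = h \<cdot> (a \<cdot> s')"
    using xs assoc[OF s' s x] assoc[OF s' a h(2)] by simp
  have y_lift: "y \<cdot> (s \<cdot> s') = h \<cdot> b"
    using ys' assoc[OF s' s y] by simp
  have "t \<cdot> (x \<cdot> (s \<cdot> s')) \<sqsubseteq> t \<cdot> (y \<cdot> (s \<cdot> s'))"
    using lifts[OF ss' as' b x_lift y_lift] x_lift y_lift by simp
  moreover have tx: "t \<cdot> x \<in> hom C W Z" and ty: "t \<cdot> y \<in> hom C W Z"
    by (rule comp_hom[OF x t], rule comp_hom[OF y t])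
  ultimately have "((t \<cdot> x) \<cdot> s) \<cdot> s' \<sqsubseteq> ((t \<cdot> y) \<cdot> s) \<cdot> s'"
    by (simp add: assoc[OF s' s tx] assoc[OF s' s ty] assoc[OF ss' x t] assoc[OF ss' y t])
  \<comment> \<open>The two \<open>so\<close>-morphisms are cancelled one after the other, so
    closure of \<open>so\<close>-morphisms under composition does not have to be
    established.\<close>
  then have "(t \<cdot> x) \<cdot> s \<sqsubseteq> (t \<cdot> y) \<cdot> s"
    using so_morphism_order_epi[OF so_s' s'] comp_hom[OF s tx] comp_hom[OF s ty] by blast
  then show ?thesis
    using so_morphism_order_epi[OF so_s s tx ty] by blast
qed

text \<open>The premise \<open>kernel\<close> is what transfers
  \<open>g \<cdot> k\<^sub>0 \<sqsubseteq> g \<cdot> k\<^sub>1\<close> to every pair that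
  \<open>e\<close> puts in order. The order-reflecting half of the coinserter property is
  \<open>so_morphism_order_epi\<close>.\<close>

lemma so_morphism_is_coinserter_of_kernel:
  assumes fact: "has_so_ff_factorizations C" and stable: "so_stable_under_pullback C"
    and so: "so_morphism C e" and e: "e \<in> hom C A B"
    and k0: "k\<^sub>0 \<in> hom C K A" and k1: "k\<^sub>1 \<in> hom C K A" and le: "e \<cdot> k\<^sub>0 \<sqsubseteq> e \<cdot> k\<^sub>1"
    and kernel: "\<And>V x y. \<lbrakk>x \<in> hom C V A; y \<in> hom C V A; e \<cdot> x \<sqsubseteq> e \<cdot> y\<rbrakk>
      \<Longrightarrow> \<exists>u\<in>hom C V K. k\<^sub>0 \<cdot> u = x \<and> k\<^sub>1 \<cdot> u = y"
  shows "is_coinserter C k\<^sub>0 k\<^sub>1 e"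
proof -
  have "\<exists>u\<in>hom C B Z. g = u \<cdot> e" if g: "g \<in> hom C A Z" and gk: "g \<cdot> k\<^sub>0 \<sqsubseteq> g \<cdot> k\<^sub>1" for Z g
  proof -
    obtain P p q where p: "p \<in> hom C P B" and q: "q \<in> hom C P Z"
      and pair: "\<And>V f g. \<lbrakk>f \<in> hom C V B; g \<in> hom C V Z\<rbrakk> \<Longrightarrow> \<exists>u\<in>hom C V P. p \<cdot> u = f \<and> q \<cdot> u = g"
      and monic: "\<And>V u v. \<lbrakk>u \<in> hom C V P; v \<in> hom C V P; p \<cdot> u \<sqsubseteq> p \<cdot> v; q \<cdot> u \<sqsubseteq> q \<cdot> v\<rbrakk> \<Longrightarrow> u \<sqsubseteq> v"
      by (rule binary_product[OF hom_objD(2)[OF e] hom_objD(2)[OF g]]) (rule that; assumption)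
    obtain r where r: "r \<in> hom C A P" "p \<cdot> r = e" "q \<cdot> r = g"
      using pair[OF e g] by auto
    then have "r \<in> Arr C" "Dom C r = A" "Cod C r = P"
      by (auto simp: hom_def)
    then obtain h m where so_h: "so_morphism C h" and ff_m: "ff_morphism C m"
      and "Dom C h = A" "Cod C h = Dom C m" "Cod C m = P" and r_mh: "r = m \<cdot> h"
      using fact unfolding has_so_ff_factorizations_def by metis
    moreover define I where "I = Dom C m"
    ultimately have h: "h \<in> hom C A I" and m: "m \<in> hom C I P"
      by (auto simp: hom_def so_morphism_def ff_morphism_def)
    have pm: "p \<cdot> m \<in> hom C I B" and qm: "q \<cdot> m \<in> hom C I Z"
      by (rule comp_hom[OF m p], rule comp_hom[OF m q])
    have e_eq: "(p \<cdot> m) \<cdot> h = e" and g_eq: "(q \<cdot> m) \<cdot> h = g"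
      using r r_mh assoc[OF h m p] assoc[OF h m q] by auto
    \<comment> \<open>This is the \<open>ff\<close> property of \<open>p \<cdot> m\<close>. As
      \<open>m\<close> is an \<open>ff\<close>-morphism and \<open>p\<close>, \<open>q\<close> are
      jointly order-monic, only the inequality of the \<open>q\<close>-components is
      missing.\<close>
    have "x \<sqsubseteq> y"
      if x: "x \<in> hom C W I" and y: "y \<in> hom C W I" and xy: "(p \<cdot> m) \<cdot> x \<sqsubseteq> (p \<cdot> m) \<cdot> y" for W x y
    proof -
      have "(q \<cdot> m) \<cdot> x \<sqsubseteq> (q \<cdot> m) \<cdot> y"
      proof (rule leq_via_so_lifts[OF stable so_h h x y qm])
        fix V s x' y'
        assume s: "s \<in> hom C V W" and x': "x' \<in> hom C V A" and y': "y' \<in> hom C V A"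
          and xs: "x \<cdot> s = h \<cdot> x'" and ys: "y \<cdot> s = h \<cdot> y'"
        have "((p \<cdot> m) \<cdot> x) \<cdot> s \<sqsubseteq> ((p \<cdot> m) \<cdot> y) \<cdot> s"
          using comp_mono_left[OF s comp_hom[OF x pm] comp_hom[OF y pm] xy] .
        \<comment> \<open>Here \<open>h \<cdot> x' = x \<cdot> s\<close> and
          \<open>(p \<cdot> m) \<cdot> h = e\<close>, and likewise for \<open>y'\<close>.\<close>
        then have "e \<cdot> x' \<sqsubseteq> e \<cdot> y'"
          using assoc[OF s x pm] assoc[OF s y pm] assoc[OF x' h pm] assoc[OF y' h pm] xs ys e_eq
          by simp
        then obtain w where w: "w \<in> hom C V K" "k\<^sub>0 \<cdot> w = x'" "k\<^sub>1 \<cdot> w = y'"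
          using kernel[OF x' y'] by auto
        have "(g \<cdot> k\<^sub>0) \<cdot> w \<sqsubseteq> (g \<cdot> k\<^sub>1) \<cdot> w"
          using comp_mono_left[OF w(1) comp_hom[OF k0 g] comp_hom[OF k1 g] gk] .
        then have "g \<cdot> x' \<sqsubseteq> g \<cdot> y'"
          by (simp add: assoc[OF w(1) k0 g] assoc[OF w(1) k1 g] w)
        then show "(q \<cdot> m) \<cdot> (h \<cdot> x') \<sqsubseteq> (q \<cdot> m) \<cdot> (h \<cdot> y')"
          using assoc[OF x' h qm] assoc[OF y' h qm] g_eq by simp
      qed
      then have "m \<cdot> x \<sqsubseteq> m \<cdot> y"
        using monic[OF comp_hom[OF x m] comp_hom[OF y m]] xy
          assoc[OF x m p] assoc[OF y m p] assoc[OF x m q] assoc[OF y m q] by simp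
      then show ?thesis
        using ff_morphismD[OF ff_m m x y] by blast
    qed
    then have ff_pm: "ff_morphism C (p \<cdot> m)"
      using pm by (auto simp: ff_morphism_def hom_def)
    \<comment> \<open>The square to be filled has \<open>h\<close> on top and the identity of
      \<open>B\<close> below. Its diagonal \<open>d\<close> satisfies
      \<open>d \<cdot> e = h\<close>, so \<open>(q \<cdot> m) \<cdot> d\<close> is the factor of
      \<open>g\<close> through \<open>e\<close>.\<close>
    have "(p \<cdot> m) \<cdot> h = Id C B \<cdot> e"
      using e_eq id_left[OF e] by simp
    then obtain d where d: "d \<in> hom C B I" "d \<cdot> e = h" "(p \<cdot> m) \<cdot> d = Id C B"
      by (rule so_morphism_fill[OF so ff_pm e pm h id_hom[OF hom_objD(2)[OF e]]])
    have "g = ((q \<cdot> m) \<cdot> d) \<cdot> e"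
      using assoc[OF e d(1) qm] d(2) g_eq by simp
    then show ?thesis
      using comp_hom[OF d(1) qm] by blast
  qed
  moreover have "u \<sqsubseteq> v" if "u \<in> hom C B Z" "v \<in> hom C B Z" "u \<cdot> e \<sqsubseteq> v \<cdot> e" for Z u v
    using so_morphism_order_epi[OF so e] that by blast
  ultimately show ?thesis
    unfolding is_coinserter_def using e k0 k1 le by (auto simp: hom_def)
qed

end

theorem proposition2p16:
  fixes C :: "('o, 'm) pos_cat"
  assumes "pos_category C"
    and R1: "has_finite_limits C"
    and R2: "has_so_ff_factorizations C"
    and R3: "so_stable_under_pullback C"
  shows "\<forall>e. so_morphism C e \<longrightarrow> effective C e"
proof (intro allI impI)
  interpret finitely_complete_pos_category C
    using assms by (simp add: finitely_complete_pos_category_def finitely_complete_pos_category_axioms_def)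
  fix e assume so: "so_morphism C e"
  then have e: "e \<in> hom C (Dom C e) (Cod C e)"
    by (simp add: so_morphism_def hom_def)
  show "effective C e"
    unfolding effective_def
    \<comment> \<open>The comma object of \<open>e\<close> with itself provides the kernel pair; its
      properties discharge the remaining premises of the coinserter lemma.\<close>
    by (rule comma[OF e e], intro exI)
      (rule so_morphism_is_coinserter_of_kernel[OF R2 R3 so e])
qed

end
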